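(* Let $A,B,C$ be a Leonard triple on $V$ that has $q$-Racah type with Huang data $(a,b,c,d)$, and let $\overline A,\overline B,\overline C\in\mathrm{End}(V)$ be as defined in the context. Then the following are equivalent: (i) $\overline A=\overline B=\overline C=0$; (ii) $a,b,c$ are mutually similar; (iii) the Leonard triple $A,B,C$ is modular.
   Context: Let $\mathbb F$ be a field, $d\ge 0$ an integer, $V$ a vector space over $\mathbb F$ of dimension $d+1$, $\mathrm{End}(V)$ the $\mathbb F$-algebra of $\mathbb F$-linear maps $V\to V$, and $I$ its identity. A square matrix is tridiagonal if each nonzero entry lies on the diagonal, subdiagonal or superdiagonal; a tridiagonal matrix is irreducible if every subdiagonal entry and every superdiagonal entry is nonzero. Leonard triple on $V$: a 3-tuple $A,B,C$ of elements of $\mathrm{End}(V)$ such that (i) there is a basis of $V$ with respect to which $A$ is represented by a diagonal matrix and $B,C$ by irreducible tridiagonal matrices; (ii) there is a basis with respect to which $B$ is diagonal and $C,A$ are irreducible tridiagonal; (iii) there is a basis with respect to which $C$ is diagonal and $A,B$ are irreducible tridiagonal. Each of $A,B,C$ is then diagonalizable with one-dimensional eigenspaces. An ordering of the eigenvalues of $A$ is standard if corresponding eigenvectors, in that order, form a basis as in (i); similarly for $B$ with (ii) and $C$ with (iii). Standing assumptions: fix a nonzero $q\in\mathbb F$ with $q^4\ne 1$ and nonzero $a,b,c\in\mathbb F$ such that $q^{2i}\ne 1$ for $1\le i\le d$; none of $a^2,b^2,c^2$ is among $q^{2d-2},q^{2d-4},\ldots,q^{2-2d}$; none of $abc,a^{-1}bc,ab^{-1}c,abc^{-1}$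 is among $q^{d-1},q^{d-3},\ldots,q^{1-d}$. For $0\le i\le d$ let $\theta_i=aq^{2i-d}+a^{-1}q^{d-2i}$, $\theta'_i=bq^{2i-d}+b^{-1}q^{d-2i}$, $\theta''_i=cq^{2i-d}+c^{-1}q^{d-2i}$. A Leonard triple $A,B,C$ on $V$ has $q$-Racah type with Huang data $(a,b,c,d)$ if $\{\theta_i\}_{i=0}^d$, $\{\theta'_i\}_{i=0}^d$, $\{\theta''_i\}_{i=0}^d$ are standard orderings of the eigenvalues of $A$, $B$, $C$ respectively, and $$A+\frac{qBC-q^{-1}CB}{q^2-q^{-2}}=\alpha_a I,\quad B+\frac{qCA-q^{-1}AC}{q^2-q^{-2}}=\alpha_b I,\quad C+\frac{qAB-q^{-1}BA}{q^2-q^{-2}}=\alpha_c I,$$ where $\alpha_a=\frac{(a+a^{-1})(q^{d+1}+q^{-d-1})+(b+b^{-1})(c+c^{-1})}{q+q^{-1}}$, $\alpha_b=\frac{(b+b^{-1})(q^{d+1}+q^{-d-1})+(c+c^{-1})(a+a^{-1})}{q+q^{-1}}$, $\alpha_c=\frac{(c+c^{-1})(q^{d+1}+q^{-d-1})+(a+a^{-1})(b+b^{-1})}{q+q^{-1}}$. For $0\le i\le d$ let $E_i$ (resp. $E'_i$, $E''_i$) be the primitive idempotent of $A$ (resp. $B$, $C$) for $\theta_i$ (resp. $\theta'_i$, $\theta''_i$): the projection of $V$ onto that eigenspace that is zero on the other eigenspaces. Define $$W=\sum_{i=0}^d(-1)^ia^{-i}q^{i(d-i)}E_i,\quad W'=\sum_{i=0}^d(-1)^ib^{-i}q^{i(d-i)}E'_i,\quad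 W''=\sum_{i=0}^d(-1)^ic^{-i}q^{i(d-i)}E''_i,$$ which are invertible, and $$\overline A=W^{-1}BW-C,\quad \overline B=(W')^{-1}CW'-A,\quad \overline C=(W'')^{-1}AW''-B.$$ Elements $x,y\in\mathbb F$ are similar if $x=y$ or $xy=1$. An antiautomorphism of $\mathrm{End}(V)$ is an $\mathbb F$-linear bijection $\dagger:\mathrm{End}(V)\to\mathrm{End}(V)$ with $(XY)^\dagger=Y^\dagger X^\dagger$ for all $X,Y$. A Leonard triple $A,B,C$ is modular if for each element among $A,B,C$ there is an antiautomorphism of $\mathrm{End}(V)$ that fixes that element and swaps the other two. *)

theory Defs
  imports Main "HOL.Vector_Spaces"
begin

text \<open>
  The vector space \<open>V\<close> is the whole type \<open>'b\<close> of the locale \<open>vector_space\<close>, and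
  \<open>(d+1) \<times> (d+1)\<close> matrices are functions \<open>nat \<Rightarrow> nat \<Rightarrow> 'a\<close> of which only the entries with
  indices in \<open>{..d}\<close> matter.
\<close>

definition diagonal_matrix :: "nat \<Rightarrow> (nat \<Rightarrow> nat \<Rightarrow> 'a::zero) \<Rightarrow> bool" where
  "diagonal_matrix d M \<longleftrightarrow> (\<forall>i\<le>d. \<forall>j\<le>d. M i j \<noteq> 0 \<longrightarrow> i = j)"

definition tridiagonal :: "nat \<Rightarrow> (nat \<Rightarrow> nat \<Rightarrow> 'a::zero) \<Rightarrow> bool" where
  "tridiagonal d M \<longleftrightarrow> (\<forall>i\<le>d. \<forall>j\<le>d. M i j \<noteq> 0 \<longrightarrow> i = j \<or> i = Suc j \<or> j = Suc i)"

definition irreducible_tridiagonal :: "nat \<Rightarrow> (nat \<Rightarrow> nat \<Rightarrow> 'a::zero) \<Rightarrow> bool" where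
  "irreducible_tridiagonal d M \<longleftrightarrow>
     tridiagonal d M \<and> (\<forall>i<d. M (Suc i) i \<noteq> 0 \<and> M i (Suc i) \<noteq> 0)"

text \<open>The scalars \<open>\<theta>\<^sub>i\<close>, \<open>\<theta>'\<^sub>i\<close>, \<open>\<theta>''\<^sub>i\<close> are \<open>qracah_theta q d x i\<close> for \<open>x = a, b, c\<close>; the scalars
  \<open>\<alpha>\<^sub>a\<close>, \<open>\<alpha>\<^sub>b\<close>, \<open>\<alpha>\<^sub>c\<close> are \<open>qracah_alpha q d\<close> at \<open>a b c\<close>, \<open>b c a\<close>, \<open>c a b\<close>.\<close>

definition qracah_theta :: "'a::field \<Rightarrow> nat \<Rightarrow> 'a \<Rightarrow> nat \<Rightarrow> 'a" where
  "qracah_theta q d x i =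
     x * q powi (2 * int i - int d) + inverse x * q powi (int d - 2 * int i)"

definition qracah_alpha :: "'a::field \<Rightarrow> nat \<Rightarrow> 'a \<Rightarrow> 'a \<Rightarrow> 'a \<Rightarrow> 'a" where
  "qracah_alpha q d x y z =
     ((x + inverse x) * (q powi (int d + 1) + q powi (- int d - 1))
        + (y + inverse y) * (z + inverse z)) / (q + inverse q)"

definition similar_scalars :: "'a::field \<Rightarrow> 'a \<Rightarrow> bool" where
  "similar_scalars x y \<longleftrightarrow> x = y \<or> x * y = 1"

context vector_space
begin

definition End :: "('b \<Rightarrow> 'b) set" where
  "End = {X. Vector_Spaces.linear scale scale X}"

definition is_basis :: "nat \<Rightarrow> (nat \<Rightarrow> 'b) \<Rightarrow> bool" where
  "is_basis d e \<longleftrightarrow> inj_on e {..d} \<and> independent (e ` {..d}) \<and> span (e ` {..d}) = UNIV"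

definition represents :: "nat \<Rightarrow> (nat \<Rightarrow> 'b) \<Rightarrow> ('b \<Rightarrow> 'b) \<Rightarrow> (nat \<Rightarrow> nat \<Rightarrow> 'a) \<Rightarrow> bool" where
  "represents d e X M \<longleftrightarrow> (\<forall>j\<le>d. X (e j) = (\<Sum>i\<le>d. M i j *s e i))"

definition diagonal_wrt :: "nat \<Rightarrow> (nat \<Rightarrow> 'b) \<Rightarrow> ('b \<Rightarrow> 'b) \<Rightarrow> bool" where
  "diagonal_wrt d e X \<longleftrightarrow> (\<exists>M. represents d e X M \<and> diagonal_matrix d M)"

definition irred_tridiag_wrt :: "nat \<Rightarrow> (nat \<Rightarrow> 'b) \<Rightarrow> ('b \<Rightarrow> 'b) \<Rightarrow> bool" where
  "irred_tridiag_wrt d e X \<longleftrightarrow> (\<exists>M. represents d e X M \<and> irreducible_tridiagonal d M)"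

definition leonard_basis ::
  "nat \<Rightarrow> ('b \<Rightarrow> 'b) \<Rightarrow> ('b \<Rightarrow> 'b) \<Rightarrow> ('b \<Rightarrow> 'b) \<Rightarrow> (nat \<Rightarrow> 'b) \<Rightarrow> bool" where
  "leonard_basis d X Y Z e \<longleftrightarrow>
     is_basis d e \<and> diagonal_wrt d e X \<and> irred_tridiag_wrt d e Y \<and> irred_tridiag_wrt d e Z"

definition leonard_triple :: "nat \<Rightarrow> ('b \<Rightarrow> 'b) \<Rightarrow> ('b \<Rightarrow> 'b) \<Rightarrow> ('b \<Rightarrow> 'b) \<Rightarrow> bool" where
  "leonard_triple d A B C \<longleftrightarrow>
     A \<in> End \<and> B \<in> End \<and> C \<in> End \<and>
     (\<exists>e. leonard_basis d A B C e) \<and>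
     (\<exists>e. leonard_basis d B C A e) \<and>
     (\<exists>e. leonard_basis d C A B e)"

definition eigenspace :: "('b \<Rightarrow> 'b) \<Rightarrow> 'a \<Rightarrow> 'b set" where
  "eigenspace X t = {v. X v = t *s v}"

definition eigenvalues :: "('b \<Rightarrow> 'b) \<Rightarrow> 'a set" where
  "eigenvalues X = {t. \<exists>v\<in>eigenspace X t. v \<noteq> 0}"

text \<open>The sequence \<open>t\<^sub>0, \<dots>, t\<^sub>d\<close> is a standard ordering of the eigenvalues of \<open>X\<close>, where \<open>X\<close> is
  the diagonal element and \<open>Y\<close>, \<open>Z\<close> are the other two members of the triple.\<close>

definition standard_ordering ::
  "nat \<Rightarrow> ('b \<Rightarrow> 'b) \<Rightarrow> ('b \<Rightarrow> 'b) \<Rightarrow> ('b \<Rightarrow> 'b) \<Rightarrow> (nat \<Rightarrow> 'a) \<Rightarrow> bool" where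
  "standard_ordering d X Y Z t \<longleftrightarrow>
     bij_betw t {..d} (eigenvalues X) \<and>
     (\<exists>e. leonard_basis d X Y Z e \<and> (\<forall>i\<le>d. e i \<in> eigenspace X (t i)))"

definition qracah_relation ::
  "'a \<Rightarrow> 'a \<Rightarrow> ('b \<Rightarrow> 'b) \<Rightarrow> ('b \<Rightarrow> 'b) \<Rightarrow> ('b \<Rightarrow> 'b) \<Rightarrow> bool" where
  "qracah_relation q \<alpha> X Y Z \<longleftrightarrow>
     (\<forall>v. X v + inverse (q powi 2 - q powi (-2)) *s (q *s Y (Z v) - inverse q *s Z (Y v)) = \<alpha> *s v)"

definition qracah_leonard_triple ::
  "'a \<Rightarrow> 'a \<Rightarrow> 'a \<Rightarrow> 'a \<Rightarrow> nat \<Rightarrow> ('b \<Rightarrow> 'b) \<Rightarrow> ('b \<Rightarrow> 'b) \<Rightarrow> ('b \<Rightarrow> 'b) \<Rightarrow> bool" where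
  "qracah_leonard_triple q a b c d A B C \<longleftrightarrow>
     leonard_triple d A B C \<and>
     standard_ordering d A B C (qracah_theta q d a) \<and>
     standard_ordering d B C A (qracah_theta q d b) \<and>
     standard_ordering d C A B (qracah_theta q d c) \<and>
     qracah_relation q (qracah_alpha q d a b c) A B C \<and>
     qracah_relation q (qracah_alpha q d b c a) B C A \<and>
     qracah_relation q (qracah_alpha q d c a b) C A B"

text \<open>The description below determines a unique map whenever \<open>X\<close> is diagonalizable.\<close>

definition primitive_idempotent :: "('b \<Rightarrow> 'b) \<Rightarrow> 'a \<Rightarrow> 'b \<Rightarrow> 'b" where
  "primitive_idempotent X t = (THE E. E \<in> End \<and>
     range E = eigenspace X t \<and>
     (\<forall>v\<in>eigenspace X t. E v = v) \<and>
     (\<forall>s. s \<noteq> t \<longrightarrow> (\<forall>v\<in>eigenspace X s. E v = 0)))"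

text \<open>\<open>W\<close>, \<open>W'\<close>, \<open>W''\<close> are \<open>W_map q d\<close> at \<open>a A\<close>, \<open>b B\<close>, \<open>c C\<close>.\<close>

definition W_map :: "'a \<Rightarrow> nat \<Rightarrow> 'a \<Rightarrow> ('b \<Rightarrow> 'b) \<Rightarrow> 'b \<Rightarrow> 'b" where
  "W_map q d x X = (\<lambda>v. \<Sum>i\<le>d.
     ((-1) ^ i * x powi (- int i) * q ^ (i * (d - i)))
       *s primitive_idempotent X (qracah_theta q d x i) v)"

text \<open>\<open>A\<close>-bar, \<open>B\<close>-bar, \<open>C\<close>-bar are \<open>bar_map q d\<close> at \<open>a A B C\<close>, \<open>b B C A\<close>, \<open>c C A B\<close>.\<close>

definition bar_map ::
  "'a \<Rightarrow> nat \<Rightarrow> 'a \<Rightarrow> ('b \<Rightarrow> 'b) \<Rightarrow> ('b \<Rightarrow> 'b) \<Rightarrow> ('b \<Rightarrow> 'b) \<Rightarrow> 'b \<Rightarrow> 'b" where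
  "bar_map q d x X Y Z = (\<lambda>v. inv (W_map q d x X) (Y (W_map q d x X v)) - Z v)"

definition antiautomorphism :: "(('b \<Rightarrow> 'b) \<Rightarrow> 'b \<Rightarrow> 'b) \<Rightarrow> bool" where
  "antiautomorphism \<tau> \<longleftrightarrow>
     bij_betw \<tau> End End \<and>
     (\<forall>X\<in>End. \<forall>Y\<in>End. \<tau> (\<lambda>v. X v + Y v) = (\<lambda>v. \<tau> X v + \<tau> Y v)) \<and>
     (\<forall>k. \<forall>X\<in>End. \<tau> (\<lambda>v. k *s X v) = (\<lambda>v. k *s \<tau> X v)) \<and>
     (\<forall>X\<in>End. \<forall>Y\<in>End. \<tau> (X \<circ> Y) = \<tau> Y \<circ> \<tau> X)"

definition modular :: "('b \<Rightarrow> 'b) \<Rightarrow> ('b \<Rightarrow> 'b) \<Rightarrow> ('b \<Rightarrow> 'b) \<Rightarrow> bool" where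
  "modular A B C \<longleftrightarrow>
     (\<exists>\<tau>. antiautomorphism \<tau> \<and> \<tau> A = A \<and> \<tau> B = C \<and> \<tau> C = B) \<and>
     (\<exists>\<tau>. antiautomorphism \<tau> \<and> \<tau> B = B \<and> \<tau> C = A \<and> \<tau> A = C) \<and>
     (\<exists>\<tau>. antiautomorphism \<tau> \<and> \<tau> C = C \<and> \<tau> A = B \<and> \<tau> B = A)"

end

end

theory Submission
  imports Defs
begin

text \<open>
  The three conditions decouple. For each member \<open>X\<close> of the triple, with \<open>Y, Z\<close> the two that
  follow it cyclically and \<open>x, y, z\<close> the matching Huang data, the following are already
  equivalent: \<open>X\<close>-bar vanishes; some antiautomorphism fixes \<open>X\<close> and swaps \<open>Y\<close> and \<open>Z\<close>; \<open>y\<close> and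
  \<open>z\<close> are similar. The hypotheses are invariant under rotating the triple, so the corollary is the
  conjunction of three instances of \<open>similar_bar_antiautomorphism\<close>.

  Everything is read off in a basis of eigenvectors of \<open>X\<close>, where \<open>X\<close> and \<open>W\<close> are diagonal
  and \<open>Y, Z\<close> are irreducible tridiagonal. The vanishing of \<open>X\<close>-bar says \<open>Y W = W Z\<close>. Three
  implications close a cycle.

  If \<open>Y W = W Z\<close>, then \<open>Y\<^sub>i\<^sub>j Y\<^sub>j\<^sub>i = Z\<^sub>i\<^sub>j Z\<^sub>j\<^sub>i\<close> and the diagonals of \<open>Y\<close> and \<open>Z\<close> agree.
  For tridiagonal matrices this is what is needed to find a diagonal matrix \<open>G\<close> for which the
  adjoint \<open>M \<mapsto> G\<close>-inverse times the transpose of \<open>M\<close> times \<open>G\<close> swaps \<open>Y\<close> and \<open>Z\<close>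
  (\<open>antiautomorphism_swap_exists\<close>).

  If an antiautomorphism swaps \<open>Y\<close> and \<open>Z\<close>, these have the same eigenvalues, and applying it
  to the relation for \<open>Y\<close> turns that into the relation for \<open>Z\<close> with the other constant, whence
  the two constants agree. Comparing sums of eigenvalues gives similarity if \<open>q\<close> to the power
  \<open>2 (d + 1)\<close> is not \<open>1\<close>; comparing constants covers the remaining case
  (\<open>similar_of_sum_and_alpha\<close>).

  If \<open>y\<close> and \<open>z\<close> are similar, then the off-diagonal part of \<open>Y W = W Z\<close> holds because the
  ratios of the entries of \<open>W\<close> are the factors by which the relations express the off-diagonal
  entries of \<open>Z\<close> through those of \<open>Y\<close> (\<open>W_weight_theta_neighbours\<close>). On the diagonal the
  relations give \<open>(Y\<^sub>i\<^sub>i - Z\<^sub>i\<^sub>i) (q + 1/q - \<theta>\<^sub>i) = 0\<close>. The eigenvalues \<open>\<theta>\<^sub>i\<close> are distinct, so at most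
  one difference survives, and it is killed by the traces of \<open>Y\<close> and \<open>Z\<close>, which are the equal
  sums of their eigenvalues.
\<close>

section \<open>Scalar identities\<close>

definition W_weight :: "'a::field \<Rightarrow> nat \<Rightarrow> 'a \<Rightarrow> nat \<Rightarrow> 'a" where
  "W_weight q d x i = (-1) ^ i * x powi (- int i) * q ^ (i * (d - i))"

lemma W_weight_nonzero: "q \<noteq> 0 \<Longrightarrow> x \<noteq> 0 \<Longrightarrow> W_weight q d x i \<noteq> (0::'a::field)"
  by (simp add: W_weight_def)

lemma W_weight_Suc:
  fixes q x :: "'a::field"
  assumes "q \<noteq> 0" "x \<noteq> 0" "i < d"
  shows "W_weight q d x i = - (x * q powi (2 * int i - int d) * q) * W_weight q d x (Suc i)"
proof -
  obtain k where d: "d = Suc (i + k)"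
    using less_imp_Suc_add[OF \<open>i < d\<close>] by auto
  have "q powi (2 * int i - int d) * q = q powi (int i - int k)"
    using assms by (simp add: d power_int_diff power_int_add field_simps)
  moreover have "q ^ (i * Suc k) = q powi (int i - int k) * q ^ (Suc i * k)"
    using assms by (simp add: power_int_diff power_add)
  moreover have "x powi (- int i) = x * x powi (- int (Suc i))"
    using assms power_int_add[of x 1 "- int (Suc i)"] by simp
  ultimately show ?thesis
    by (simp add: W_weight_def d Suc_diff_le ac_simps)
qed

lemma q_square_diff_nonzero:
  fixes q :: "'a::field"
  assumes "q \<noteq> 0" "q ^ 4 \<noteq> 1"
  shows "q powi 2 - q powi (- 2) \<noteq> 0" "q\<^sup>2 \<noteq> 1" "q + inverse q \<noteq> 0" "q - inverse q \<noteq> 0"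
proof -
  have "q ^ 4 - 1 = (q\<^sup>2 - 1) * (q\<^sup>2 + 1)"
    by (simp add: algebra_simps power2_eq_square eval_nat_numeral)
  with assms have *: "q\<^sup>2 - 1 \<noteq> 0" "q\<^sup>2 + 1 \<noteq> 0" by auto
  show "q\<^sup>2 \<noteq> 1" using * by simp
  show "q + inverse q \<noteq> 0" "q - inverse q \<noteq> 0"
    using * assms(1) by (auto simp: field_simps power2_eq_square)
  have "q powi 2 - q powi (- 2) = (q ^ 4 - 1) / q\<^sup>2"
    using assms(1) by (simp add: power_int_minus field_simps flip: power_add)
  then show "q powi 2 - q powi (- 2) \<noteq> 0" using assms by simp
qed

text \<open>
  For \<open>i \<noteq> j\<close> the relation for \<open>Z\<close> expresses \<open>Z\<^sub>i\<^sub>j\<close> as \<open>Y\<^sub>i\<^sub>j\<close> times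
  \<open>- (q \<theta>\<^sub>i - \<theta>\<^sub>j / q) / (q\<^sup>2 - 1/q\<^sup>2)\<close>. For neighbouring indices one of the two summands of \<open>\<theta>\<close>
  cancels in that factor, which leaves a monomial, namely the quotient of two consecutive
  coefficients of \<open>W\<close>.
\<close>

lemma W_weight_theta_neighbours:
  fixes q x :: "'a::field"
  assumes "q \<noteq> 0" "x \<noteq> 0" "i < d"
  shows "W_weight q d x (Suc i) * (q * qracah_theta q d x (Suc i) - inverse q * qracah_theta q d x i)
           = - (q powi 2 - q powi (- 2)) * W_weight q d x i"
    and "W_weight q d x i * (q * qracah_theta q d x i - inverse q * qracah_theta q d x (Suc i))
           = - (q powi 2 - q powi (- 2)) * W_weight q d x (Suc i)"
proof -
  \<comment> \<open>In terms of \<open>x\<close>, \<open>q\<close> and this power all exponents become numerals.\<close>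
  define u where "u = q powi (2 * int i - int d)"
  have u: "u \<noteq> 0" using assms by (simp add: u_def)
  have neg: "q powi (int d - 2 * int i) = inverse u"
    unfolding u_def by (simp flip: power_int_minus)
  have up: "q powi (2 * int (Suc i) - int d) = u * q\<^sup>2"
    using assms by (simp add: u_def power_int_diff power_int_add algebra_simps)
  have "q powi (int d - 2 * int (Suc i)) = inverse (q powi (2 * int (Suc i) - int d))"
    by (simp flip: power_int_minus)
  then have down: "q powi (int d - 2 * int (Suc i)) = inverse (u * q\<^sup>2)" by (simp only: up)
  have th: "qracah_theta q d x i = x * u + inverse (x * u)"
    "qracah_theta q d x (Suc i) = x * (u * q\<^sup>2) + inverse (x * (u * q\<^sup>2))"
    by (simp_all only: qracah_theta_def neg up down u_def[symmetric] inverse_mult_distrib)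
  have w: "W_weight q d x i = - (x * u * q) * W_weight q d x (Suc i)"
    using W_weight_Suc[OF assms] by (simp add: u_def)
  have "q * qracah_theta q d x (Suc i) - inverse q * qracah_theta q d x i
      = (q powi 2 - q powi (- 2)) * (x * u * q)"
    using assms u by (simp add: th power_int_minus field_simps eval_nat_numeral)
  then show "W_weight q d x (Suc i) *
      (q * qracah_theta q d x (Suc i) - inverse q * qracah_theta q d x i)
           = - (q powi 2 - q powi (- 2)) * W_weight q d x i"
    unfolding w by (simp only:) (simp add: algebra_simps)
  have inv: "(x * u * q) * (q * qracah_theta q d x i - inverse q * qracah_theta q d x (Suc i))
      = q powi 2 - q powi (- 2)"
    using assms u by (simp add: th power_int_minus field_simps eval_nat_numeral)
  show "W_weight q d x i *
      (q * qracah_theta q d x i - inverse q * qracah_theta q d x (Suc i))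
           = - (q powi 2 - q powi (- 2)) * W_weight q d x (Suc i)"
    unfolding w inv[symmetric] by (simp add: ac_simps)
qed

lemma similar_scalars_iff:
  fixes x y :: "'a::field"
  assumes "x \<noteq> 0" "y \<noteq> 0"
  shows "similar_scalars x y \<longleftrightarrow> x + inverse x = y + inverse y"
proof -
  have "x + inverse x - (y + inverse y) = (x - y) * (x * y - 1) / (x * y)"
    using assms by (simp add: field_simps)
  then have "x + inverse x = y + inverse y \<longleftrightarrow> (x - y) * (x * y - 1) = 0"
    using assms by (metis divide_eq_0_iff eq_iff_diff_eq_0 mult_eq_0_iff)
  then show ?thesis by (auto simp: similar_scalars_def)
qed

text \<open>The factor \<open>q - 1/q\<close> makes the geometric sum telescope.\<close>

lemma sum_qracah_theta:
  fixes q x :: "'a::field"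
  assumes "q \<noteq> 0"
  shows "(\<Sum>i\<le>d. qracah_theta q d x i) * (q - inverse q)
           = (x + inverse x) * (q ^ (d + 1) - inverse (q ^ (d + 1)))"
proof -
  define S where "S = (\<Sum>i\<le>d. q powi (2 * int i - int d))"
  have "(\<Sum>i\<le>d. q powi (int d - 2 * int i)) = S"
    unfolding S_def
    by (rule sum.reindex_bij_witness[where i = "\<lambda>i. d - i" and j = "\<lambda>i. d - i"])
      (auto simp: of_nat_diff algebra_simps)
  then have sum: "(\<Sum>i\<le>d. qracah_theta q d x i) = (x + inverse x) * S"
    by (simp add: qracah_theta_def sum.distrib S_def distrib_right flip: sum_distrib_left)
  have tel: "q powi (2 * int i - int d) * (q - inverse q)
      = q powi (2 * int (Suc i) - int d - 1) - q powi (2 * int i - int d - 1)" for i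
    using assms by (simp add: power_int_diff power_int_add field_simps power2_eq_square)
  have "S * (q - inverse q)
      = (\<Sum>i<Suc d. q powi (2 * int (Suc i) - int d - 1) - q powi (2 * int i - int d - 1))"
    unfolding S_def sum_distrib_right tel lessThan_Suc_atMost ..
  also have "\<dots> = q powi (2 * int (Suc d) - int d - 1) - q powi (2 * int 0 - int d - 1)"
    by (rule sum_lessThan_telescope)
  also have "2 * int (Suc d) - int d - 1 = int (d + 1)" by simp
  also have "2 * int 0 - int d - 1 = - int (d + 1)" by simp
  finally have "S * (q - inverse q) = q ^ (d + 1) - inverse (q ^ (d + 1))"
    by (simp only: power_int_minus power_int_of_nat)
  then show ?thesis by (simp add: sum mult.assoc)
qed

lemma qracah_alpha_diff:
  fixes q :: "'a::field"
  assumes "q \<noteq> 0" "q ^ 4 \<noteq> 1"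
  shows "(qracah_alpha q d y z x - qracah_alpha q d z x y) * (q + inverse q)
    = ((y + inverse y) - (z + inverse z)) * (q ^ (d + 1) + inverse (q ^ (d + 1)) - (x + inverse x))"
proof -
  have "int d + 1 = int (d + 1)" "- int d - 1 = - int (d + 1)" by simp_all
  then have "q powi (int d + 1) = q ^ (d + 1)" "q powi (- int d - 1) = inverse (q ^ (d + 1))"
    by (simp_all only: power_int_minus power_int_of_nat)
  then show ?thesis
    unfolding qracah_alpha_def diff_divide_distrib[symmetric] times_divide_eq_left
      nonzero_mult_div_cancel_right[OF q_square_diff_nonzero(3)[OF assms]]
    by (simp only:) (simp add: algebra_simps)
qed

text \<open>
  Put \<open>p = q ^ (d + 1)\<close>. If \<open>y\<close> and \<open>z\<close> are not similar, \<open>sums\<close> and \<open>alphas\<close> force \<open>p = 1/p\<close> and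
  \<open>p + 1/p = x + 1/x\<close>. Then \<open>p\<^sup>2 = 1\<close>, so \<open>x\<close> is a root of \<open>t\<^sup>2 - 2 p t + 1 = (t - p)\<^sup>2\<close>, that is
  \<open>x = p\<close> and \<open>x\<^sup>2 = 1\<close>. For \<open>d = 0\<close> the contradiction comes from \<open>p = q\<close> and \<open>q\<^sup>2 \<noteq> 1\<close> instead.
\<close>

lemma similar_of_sum_and_alpha:
  fixes q x y z :: "'a::field"
  assumes q: "q \<noteq> 0" "q ^ 4 \<noteq> 1" and "x \<noteq> 0" "y \<noteq> 0" "z \<noteq> 0"
    and x: "d \<ge> 1 \<Longrightarrow> x\<^sup>2 \<noteq> 1"
    and sums: "(\<Sum>i\<le>d. qracah_theta q d y i) = (\<Sum>i\<le>d. qracah_theta q d z i)"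
    and alphas: "qracah_alpha q d y z x = qracah_alpha q d z x y"
  shows "similar_scalars y z"
proof (rule ccontr)
  define p where "p = q ^ (d + 1)"
  have p: "p \<noteq> 0" using q by (simp add: p_def)
  assume "\<not> similar_scalars y z"
  then have ne: "(y + inverse y) - (z + inverse z) \<noteq> 0"
    using assms by (simp add: similar_scalars_iff)
  have "((y + inverse y) - (z + inverse z)) * (p - inverse p) = 0"
    using sums sum_qracah_theta[OF q(1), of d y] sum_qracah_theta[OF q(1), of d z]
    by (simp only: left_diff_distrib p_def) simp
  then have pp: "p = inverse p" using ne by simp
  then have p2: "p\<^sup>2 = 1" using p by (metis power2_eq_square right_inverse)
  have "((y + inverse y) - (z + inverse z)) * (p + inverse p - (x + inverse x)) = 0"
    using alphas qracah_alpha_diff[OF q, of d y z x] by (simp add: p_def)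
  then have "p + p = x + inverse x" using ne pp by simp
  then have "(x - p)\<^sup>2 = 0"
    using p2 \<open>x \<noteq> 0\<close> by (simp add: field_simps power2_eq_square)
  then have "x\<^sup>2 = 1" using p2 by simp
  then have "d = 0" using x by (cases d) auto
  then show False using p2 q_square_diff_nonzero(2)[OF q] by (simp add: p_def)
qed

section \<open>Coordinates, matrix entries and the trace\<close>

context vector_space
begin

definition coord :: "nat \<Rightarrow> (nat \<Rightarrow> 'b) \<Rightarrow> 'b \<Rightarrow> nat \<Rightarrow> 'a" where
  "coord d e v i = representation (e ` {..d}) v (e i)"

definition entry :: "nat \<Rightarrow> (nat \<Rightarrow> 'b) \<Rightarrow> ('b \<Rightarrow> 'b) \<Rightarrow> nat \<Rightarrow> nat \<Rightarrow> 'a" where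
  "entry d e X i j = coord d e (X (e j)) i"

lemma coord_expand:
  assumes "is_basis d e"
  shows "(\<Sum>i\<le>d. coord d e v i *s e i) = v"
proof -
  have "(\<Sum>b\<in>e ` {..d}. representation (e ` {..d}) v b *s b) = v"
    using assms by (intro sum_representation_eq) (auto simp: is_basis_def)
  then show ?thesis
    using assms by (simp add: is_basis_def coord_def sum.reindex)
qed

lemma coord_basis:
  assumes "is_basis d e" "i \<le> d" "j \<le> d"
  shows "coord d e (e j) i = (if i = j then 1 else 0)"
  using assms unfolding coord_def is_basis_def
  by (subst representation_basis) (auto simp: inj_on_def)

lemma coord_linear:
  assumes "is_basis d e"
  shows coord_add: "coord d e (u + v) i = coord d e u i + coord d e v i"
    and coord_diff: "coord d e (u - v) i = coord d e u i - coord d e v i"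
    and coord_scale: "coord d e (k *s v) i = k * coord d e v i"
    and coord_sum: "coord d e (\<Sum>l\<in>L. f l) i = (\<Sum>l\<in>L. coord d e (f l) i)"
  using assms
  by (simp_all add: coord_def is_basis_def representation_add representation_diff
      representation_scale representation_sum)

lemma coord_combination:
  assumes "is_basis d e" "i \<le> d"
  shows "coord d e (\<Sum>j\<le>d. f j *s e j) i = f i"
  using assms by (simp add: coord_sum coord_scale coord_basis if_distrib cong: if_cong)

lemma coord_eqI:
  assumes "is_basis d e" "\<And>i. i \<le> d \<Longrightarrow> coord d e u i = coord d e v i"
  shows "u = v"
  using coord_expand[OF assms(1), of u] coord_expand[OF assms(1), of v] assms(2)
  by (metis (no_types, lifting) atMost_iff sum.cong)

lemma basis_nonzero:
  assumes "is_basis d e" "i \<le> d"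
  shows "e i \<noteq> 0"
  using coord_basis[OF assms assms(2)] coord_scale[OF assms(1), of 0 "e i" i] by auto

lemma End_linear:
  assumes "X \<in> End"
  shows End_add: "X (u + v) = X u + X v"
    and End_scale: "X (k *s v) = k *s X v"
    and End_diff: "X (u - v) = X u - X v"
    and End_sum: "X (\<Sum>l\<in>L. f l) = (\<Sum>l\<in>L. X (f l))"
proof -
  interpret X: Vector_Spaces.linear scale scale X using assms by (simp add: End_def)
  show "X (u + v) = X u + X v" "X (k *s v) = k *s X v" "X (u - v) = X u - X v"
    "X (\<Sum>l\<in>L. f l) = (\<Sum>l\<in>L. X (f l))"
    by (simp_all add: X.add X.scale X.diff X.sum)
qed

lemma EndI:
  assumes "\<And>u v. X (u + v) = X u + X v" "\<And>k v. X (k *s v) = k *s X v"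
  shows "X \<in> End"
  unfolding End_def using assms by (simp add: linear_iff vector_space_axioms)

lemma End_closed:
  shows End_id: "(\<lambda>v. v) \<in> End"
    and End_comp: "X \<in> End \<Longrightarrow> Y \<in> End \<Longrightarrow> X \<circ> Y \<in> End"
    and End_plus: "X \<in> End \<Longrightarrow> Y \<in> End \<Longrightarrow> (\<lambda>v. X v + Y v) \<in> End"
    and End_smult: "X \<in> End \<Longrightarrow> (\<lambda>v. k *s X v) \<in> End"
  by (auto intro!: EndI simp: End_add End_scale algebra_simps mult.commute)

lemma End_expand:
  assumes "is_basis d e" "X \<in> End"
  shows "X v = (\<Sum>j\<le>d. coord d e v j *s X (e j))"
  using End_sum[OF assms(2), of "\<lambda>j. coord d e v j *s e j" "{..d}"] assms
  by (simp add: coord_expand End_scale)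

lemma coord_End:
  assumes "is_basis d e" "X \<in> End"
  shows "coord d e (X v) i = (\<Sum>j\<le>d. entry d e X i j * coord d e v j)"
  by (subst End_expand[OF assms]) (simp add: assms coord_sum coord_scale entry_def mult.commute)

lemma entry_comp:
  assumes "is_basis d e" "X \<in> End"
  shows "entry d e (X \<circ> Y) i j = (\<Sum>l\<le>d. entry d e X i l * entry d e Y l j)"
  using coord_End[OF assms, of "Y (e j)" i] by (simp add: entry_def)

lemma entry_plus:
  "is_basis d e \<Longrightarrow> entry d e (\<lambda>v. X v + Y v) i j = entry d e X i j + entry d e Y i j"
  by (simp add: entry_def coord_add)

lemma entry_smult:
  "is_basis d e \<Longrightarrow> entry d e (\<lambda>v. k *s X v) i j = k * entry d e X i j"
  by (simp add: entry_def coord_scale)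

lemma End_eqI:
  assumes "is_basis d e" "X \<in> End" "Y \<in> End"
    and "\<And>i j. i \<le> d \<Longrightarrow> j \<le> d \<Longrightarrow> entry d e X i j = entry d e Y i j"
  shows "X = Y"
proof
  fix v show "X v = Y v"
    by (rule coord_eqI[OF assms(1)]) (simp add: coord_End assms)
qed

lemma entry_represents:
  assumes "is_basis d e" "represents d e X M" "i \<le> d" "j \<le> d"
  shows "entry d e X i j = M i j"
  using assms by (simp add: represents_def entry_def coord_combination)

text \<open>
  Expanding \<open>e i\<close> along \<open>f\<close> inside \<open>X (e i)\<close> writes the trace as a double sum over both bases; summing over
  \<open>i\<close> first reassembles the coordinates of \<open>X (f k)\<close> with respect to \<open>e\<close> into the vector itself.
\<close>

lemma trace_independent_of_basis:
  assumes e: "is_basis d e" and f: "is_basis m f" and X: "X \<in> End"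
  shows "(\<Sum>i\<le>d. entry d e X i i) = (\<Sum>k\<le>m. entry m f X k k)"
proof -
  have "entry d e X i i = (\<Sum>k\<le>m. coord m f (e i) k * coord d e (X (f k)) i)" for i
    unfolding entry_def by (subst End_expand[OF f X]) (simp add: coord_sum coord_scale e)
  then have "(\<Sum>i\<le>d. entry d e X i i)
      = (\<Sum>i\<le>d. \<Sum>k\<le>m. coord m f (e i) k * coord d e (X (f k)) i)" by simp
  also have "\<dots> = (\<Sum>k\<le>m. \<Sum>i\<le>d. coord m f (e i) k * coord d e (X (f k)) i)"
    by (rule sum.swap)
  also have "\<dots> = (\<Sum>k\<le>m. coord m f (\<Sum>i\<le>d. coord d e (X (f k)) i *s e i) k)"
    by (simp add: coord_sum coord_scale f mult.commute)
  also have "\<dots> = (\<Sum>k\<le>m. entry m f X k k)"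
    by (simp add: coord_expand e entry_def)
  finally show ?thesis .
qed

lemma entry_diagonal:
  assumes "is_basis d e" "\<And>j. j \<le> d \<Longrightarrow> X (e j) = s j *s e j" "i \<le> d" "j \<le> d"
  shows "entry d e X i j = (if i = j then s j else 0)"
  using assms by (simp add: entry_def coord_scale coord_basis)

lemma trace_diagonalizable:
  assumes "is_basis d e" "is_basis d f" "X \<in> End" "\<And>j. j \<le> d \<Longrightarrow> X (f j) = s j *s f j"
  shows "(\<Sum>i\<le>d. entry d e X i i) = (\<Sum>i\<le>d. s i)"
  using trace_independent_of_basis[OF assms(1-3)] entry_diagonal[OF assms(2,4)] by simp

lemma coord_diagonalizable:
  assumes "is_basis d e" "X \<in> End" "\<And>j. j \<le> d \<Longrightarrow> X (e j) = s j *s e j" "i \<le> d"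
  shows "coord d e (X v) i = s i * coord d e v i"
  using assms(4)
  by (simp add: coord_End[OF assms(1,2)] entry_diagonal[OF assms(1,3)] if_distrib[of "\<lambda>x. x * _"]
      cong: if_cong)

lemma primitive_idempotent_eq:
  assumes e: "is_basis d e" and X: "X \<in> End" and diag: "\<And>j. j \<le> d \<Longrightarrow> X (e j) = s j *s e j"
    and inj: "inj_on s {..d}" and i: "i \<le> d"
  shows "primitive_idempotent X (s i) = (\<lambda>v. coord d e v i *s e i)"
  unfolding primitive_idempotent_def
proof (rule the_equality)
  have eig: "v = coord d e v i *s e i" if "v \<in> eigenspace X (s i)" for v
  proof (rule coord_eqI[OF e])
    fix j assume j: "j \<le> d"
    have "s j * coord d e v j = s i * coord d e v j"
      using that coord_diagonalizable[OF e X diag j, of v]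
      by (auto simp: eigenspace_def coord_scale e)
    then show "coord d e v j = coord d e (coord d e v i *s e i) j"
      using inj_onD[OF inj, of j i] i j
      by (cases "j = i") (auto simp: coord_scale coord_basis e)
  qed
  have other: "coord d e v i = 0" if "v \<in> eigenspace X t" "t \<noteq> s i" for v t
    using that coord_diagonalizable[OF e X diag i, of v]
    by (auto simp: eigenspace_def coord_scale e)
  have mem: "k *s e i \<in> eigenspace X (s i)" for k
    using i diag[OF i] by (simp add: eigenspace_def End_scale[OF X] mult.commute)
  let ?P = "\<lambda>v. coord d e v i *s e i"
  have "range ?P = eigenspace X (s i)"
  proof
    show "range ?P \<subseteq> eigenspace X (s i)" using mem by auto
    show "eigenspace X (s i) \<subseteq> range ?P" using eig by blast
  qed
  moreover have "?P \<in> End"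
    by (auto intro!: EndI simp: coord_add coord_scale e algebra_simps)
  ultimately show "?P \<in> End \<and> range ?P = eigenspace X (s i) \<and>
      (\<forall>v\<in>eigenspace X (s i). ?P v = v) \<and> (\<forall>t. t \<noteq> s i \<longrightarrow> (\<forall>v\<in>eigenspace X t. ?P v = 0))"
    using eig other by auto
  fix E assume E: "E \<in> End \<and> range E = eigenspace X (s i) \<and>
      (\<forall>v\<in>eigenspace X (s i). E v = v) \<and> (\<forall>t. t \<noteq> s i \<longrightarrow> (\<forall>v\<in>eigenspace X t. E v = 0))"
  have "E (e j) = (if j = i then e i else 0)" if "j \<le> d" for j
    using E inj i that diag by (auto simp: eigenspace_def dest: inj_onD)
  then have "E v = (\<Sum>j\<le>d. if j = i then coord d e v i *s e i else 0)" for v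
    by (subst End_expand[OF e conjunct1[OF E]], intro sum.cong) auto
  then show "E = ?P" using i by auto
qed

section \<open>Antiautomorphisms\<close>

lemma antiautomorphism_bij: "antiautomorphism \<tau> \<Longrightarrow> bij_betw \<tau> End End"
  unfolding antiautomorphism_def by (rule conjunct1)

lemma antiautomorphism_End: "antiautomorphism \<tau> \<Longrightarrow> X \<in> End \<Longrightarrow> \<tau> X \<in> End"
  using bij_betw_apply[OF antiautomorphism_bij[of \<tau>], of X] by (simp only:)

lemma antiautomorphism_add:
  assumes "antiautomorphism \<tau>" and X: "X \<in> End" and Y: "Y \<in> End"
  shows "\<tau> (\<lambda>v. X v + Y v) = (\<lambda>v. \<tau> X v + \<tau> Y v)"
proof -
  note laws = conjunct2[OF assms(1)[unfolded antiautomorphism_def]]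
  show ?thesis by (rule bspec[OF bspec[OF conjunct1[OF laws] X] Y])
qed

lemma antiautomorphism_smult:
  assumes "antiautomorphism \<tau>" and X: "X \<in> End"
  shows "\<tau> (\<lambda>v. k *s X v) = (\<lambda>v. k *s \<tau> X v)"
proof -
  note laws = conjunct2[OF assms(1)[unfolded antiautomorphism_def]]
  show ?thesis by (rule bspec[OF spec[OF conjunct1[OF conjunct2[OF laws]]] X])
qed

lemma antiautomorphism_comp:
  assumes "antiautomorphism \<tau>" and X: "X \<in> End" and Y: "Y \<in> End"
  shows "\<tau> (X \<circ> Y) = \<tau> Y \<circ> \<tau> X"
proof -
  note laws = conjunct2[OF assms(1)[unfolded antiautomorphism_def]]
  show ?thesis by (rule bspec[OF bspec[OF conjunct2[OF conjunct2[OF laws]] X] Y])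
qed

lemma antiautomorphism_id:
  assumes "antiautomorphism \<tau>"
  shows "\<tau> (\<lambda>v. v) = (\<lambda>v. v)"
proof -
  have "(\<lambda>v. v) \<in> \<tau> ` End"
    unfolding bij_betw_imp_surj_on[OF antiautomorphism_bij[OF assms]] by (rule End_id)
  then obtain X where X: "X \<in> End" "(\<lambda>v. v) = \<tau> X" by (rule imageE)
  have "(\<lambda>v. v) = \<tau> X" by (rule X(2))
  also have "\<dots> = \<tau> (X \<circ> (\<lambda>v. v))" by (simp add: o_def)
  also have "\<dots> = \<tau> (\<lambda>v. v) \<circ> \<tau> X"
    by (rule antiautomorphism_comp[OF assms X(1) End_id])
  also have "\<dots> = \<tau> (\<lambda>v. v)" by (simp add: X(2)[symmetric] o_def)
  finally show ?thesis by (rule sym)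
qed

lemma antiautomorphism_scalar:
  assumes "antiautomorphism \<tau>"
  shows "\<tau> (\<lambda>v. k *s v) = (\<lambda>v. k *s v)"
  using antiautomorphism_smult[OF assms End_id, of k] antiautomorphism_id[OF assms] by simp

text \<open>
  If \<open>t\<close> is not an eigenvalue of \<open>X\<close>, then in finite dimension \<open>X - t I\<close> has an inverse, whose
  image under \<open>\<tau>\<close> inverts \<open>\<tau> X - t I\<close>.
\<close>

lemma eigenvalues_antiautomorphism_subset:
  assumes e: "is_basis d e" and \<tau>: "antiautomorphism \<tau>" and X: "X \<in> End"
  shows "eigenvalues (\<tau> X) \<subseteq> eigenvalues X"
proof
  fix t assume "t \<in> eigenvalues (\<tau> X)"
  then obtain w where w: "\<tau> X w = t *s w" "w \<noteq> 0" by (auto simp: eigenvalues_def eigenspace_def)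
  define N where "N = (\<lambda>v. X v + (- t) *s v)"
  have N: "N \<in> End" unfolding N_def by (intro End_plus X End_smult End_id)
  have \<tau>N: "\<tau> N = (\<lambda>v. \<tau> X v + (- t) *s v)"
    unfolding N_def
    by (simp add: antiautomorphism_add[OF \<tau> X End_smult[OF End_id]] antiautomorphism_scalar[OF \<tau>]
        del: scale_minus_left)
  show "t \<in> eigenvalues X"
  proof (rule ccontr)
    assume "t \<notin> eigenvalues X"
    then have ker: "v = 0" if "N v = 0" for v
      using that by (auto simp: eigenvalues_def eigenspace_def N_def)
    have "inj N"
    proof (rule injI)
      fix u v assume "N u = N v"
      then have "N (u - v) = 0" by (simp add: End_diff[OF N])
      then show "u = v" using ker by fastforce
    qed
    interpret fin: finite_dimensional_vector_space scale "e ` {..d}"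
      using e by unfold_locales (auto simp: is_basis_def)
    have "surj N"
      using fin.linear_inj_imp_surj[OF _ \<open>inj N\<close>] N by (simp add: End_def)
    define M where "M = inv N"
    have NM: "N (M v) = v" for v unfolding M_def by (rule surj_f_inv_f[OF \<open>surj N\<close>])
    have M: "M \<in> End"
      by (rule EndI; rule injD[OF \<open>inj N\<close>]) (simp_all only: NM End_add[OF N] End_scale[OF N])
    have "N \<circ> M = (\<lambda>v. v)" by (simp add: fun_eq_iff NM)
    then have "\<tau> M \<circ> \<tau> N = (\<lambda>v. v)"
      using antiautomorphism_comp[OF \<tau> N M] antiautomorphism_id[OF \<tau>] by simp
    then have "\<tau> M (\<tau> N w) = w" by (simp add: fun_eq_iff)
    moreover have "\<tau> N w = 0" by (simp add: \<tau>N w)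
    moreover have "\<tau> M 0 = 0"
      using End_diff[OF antiautomorphism_End[OF \<tau> M], of 0 0] by simp
    ultimately show False using w by simp
  qed
qed

text \<open>The reversal of products by \<open>\<tau>\<close> is absorbed by exchanging the roles of \<open>Y\<close> and \<open>Z\<close>.\<close>

lemma qracah_relation_antiautomorphism:
  assumes \<tau>: "antiautomorphism \<tau>" and End: "X \<in> End" "Y \<in> End" "Z \<in> End"
    and "qracah_relation q \<alpha> X Y Z"
  shows "qracah_relation q \<alpha> (\<tau> X) (\<tau> Z) (\<tau> Y)"
proof -
  define k where "k = inverse (q powi 2 - q powi (-2))"
  define F where "F = (\<lambda>v. (k * q) *s (Y \<circ> Z) v)"
  define G where "G = (\<lambda>v. (- (k * inverse q)) *s (Z \<circ> Y) v)"
  define H where "H = (\<lambda>v. F v + G v)"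
  have FG: "F \<in> End" "G \<in> End"
    unfolding F_def G_def by (rule End_smult, rule End_comp, rule End, rule End)+
  have H: "H \<in> End" unfolding H_def by (rule End_plus[OF FG])
  have "(\<lambda>v. X v + H v) = (\<lambda>v. \<alpha> *s v)"
    using assms(5)
    by (simp add: qracah_relation_def fun_eq_iff k_def scale_right_diff_distrib F_def G_def H_def)
  from arg_cong[OF this, of \<tau>] have "(\<lambda>v. \<tau> X v + \<tau> H v) = (\<lambda>v. \<alpha> *s v)"
    unfolding antiautomorphism_add[OF \<tau> End(1) H] antiautomorphism_scalar[OF \<tau>] .
  moreover have "\<tau> H = (\<lambda>v. \<tau> F v + \<tau> G v)"
    unfolding H_def by (rule antiautomorphism_add[OF \<tau> FG])
  moreover have "\<tau> F = (\<lambda>v. (k * q) *s \<tau> (Y \<circ> Z) v)"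
    unfolding F_def by (rule antiautomorphism_smult[OF \<tau> End_comp[OF End(2,3)]])
  moreover have "\<tau> G = (\<lambda>v. (- (k * inverse q)) *s \<tau> (Z \<circ> Y) v)"
    unfolding G_def by (rule antiautomorphism_smult[OF \<tau> End_comp[OF End(3,2)]])
  moreover have "\<tau> (Y \<circ> Z) = \<tau> Z \<circ> \<tau> Y" "\<tau> (Z \<circ> Y) = \<tau> Y \<circ> \<tau> Z"
    by (rule antiautomorphism_comp[OF \<tau> End(2,3)], rule antiautomorphism_comp[OF \<tau> End(3,2)])
  ultimately have "(\<lambda>v. \<tau> X v + ((k * q) *s (\<tau> Z \<circ> \<tau> Y) v + (- (k * inverse q)) *s (\<tau> Y \<circ> \<tau> Z) v))
      = (\<lambda>v. \<alpha> *s v)" by (simp only:)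
  then show ?thesis
    by (simp add: qracah_relation_def fun_eq_iff k_def scale_right_diff_distrib)
qed

text \<open>
  The adjoint of \<open>X\<close> for the bilinear form in which the basis \<open>e\<close> is orthogonal and \<open>e i\<close> has
  square length \<open>g i\<close>.
\<close>

definition weighted_transpose ::
  "nat \<Rightarrow> (nat \<Rightarrow> 'b) \<Rightarrow> (nat \<Rightarrow> 'a) \<Rightarrow> ('b \<Rightarrow> 'b) \<Rightarrow> 'b \<Rightarrow> 'b" where
  "weighted_transpose d e g X =
     (\<lambda>v. \<Sum>i\<le>d. (\<Sum>j\<le>d. entry d e X j i * (g j / g i) * coord d e v j) *s e i)"

lemma coord_weighted_transpose:
  assumes "is_basis d e" "i \<le> d"
  shows "coord d e (weighted_transpose d e g X v) i
    = (\<Sum>j\<le>d. entry d e X j i * (g j / g i) * coord d e v j)"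
  unfolding weighted_transpose_def by (rule coord_combination[OF assms])

lemma weighted_transpose_End:
  assumes "is_basis d e"
  shows "weighted_transpose d e g X \<in> End"
  by (rule EndI; rule coord_eqI[OF assms])
    (simp_all add: coord_weighted_transpose coord_add coord_scale assms distrib_left sum.distrib
      sum_distrib_left mult.left_commute)

lemma entry_weighted_transpose:
  assumes "is_basis d e" "i \<le> d" "j \<le> d"
  shows "entry d e (weighted_transpose d e g X) i j = entry d e X j i * (g j / g i)"
proof -
  have "entry d e (weighted_transpose d e g X) i j
      = (\<Sum>l\<le>d. if l = j then entry d e X j i * (g j / g i) else 0)"
    unfolding entry_def[of _ _ "weighted_transpose d e g X"]
    unfolding coord_weighted_transpose[OF assms(1,2)]
    by (rule sum.cong) (auto simp: coord_basis[OF assms(1) _ assms(3)])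
  then show ?thesis using assms(3) by simp
qed

lemma antiautomorphism_weighted_transpose:
  assumes e: "is_basis d e" and g: "\<And>i. i \<le> d \<Longrightarrow> g i \<noteq> 0"
  shows "antiautomorphism (weighted_transpose d e g)"
proof -
  let ?\<tau> = "weighted_transpose d e g"
  note E = weighted_transpose_End[OF e]
  note ent = entry_weighted_transpose[OF e]
  have inv: "?\<tau> (?\<tau> X) = X" if "X \<in> End" for X
    by (rule End_eqI[OF e E that]) (simp add: ent g)
  have bij: "bij_betw ?\<tau> End End"
    by (rule bij_betw_byWitness[where f' = ?\<tau>]) (auto simp: inv E)
  have add: "?\<tau> (\<lambda>v. X v + Y v) = (\<lambda>v. ?\<tau> X v + ?\<tau> Y v)" for X Y
  proof (rule End_eqI[OF e E End_plus[OF E E]])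
    fix i j assume "i \<le> d" "j \<le> d"
    then show "entry d e (?\<tau> (\<lambda>v. X v + Y v)) i j = entry d e (\<lambda>v. ?\<tau> X v + ?\<tau> Y v) i j"
      by (simp only: ent entry_plus[OF e] distrib_right)
  qed
  have scale: "?\<tau> (\<lambda>v. k *s X v) = (\<lambda>v. k *s ?\<tau> X v)" for k X
  proof (rule End_eqI[OF e E End_smult[OF E]])
    fix i j assume "i \<le> d" "j \<le> d"
    then show "entry d e (?\<tau> (\<lambda>v. k *s X v)) i j = entry d e (\<lambda>v. k *s ?\<tau> X v) i j"
      by (simp only: ent entry_smult[OF e] mult.assoc)
  qed
  have comp: "?\<tau> (X \<circ> Y) = ?\<tau> Y \<circ> ?\<tau> X" if "X \<in> End" "Y \<in> End" for X Y
  proof (rule End_eqI[OF e E End_comp[OF E E]])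
    fix i j assume ij: "i \<le> d" "j \<le> d"
    have "entry d e (?\<tau> Y \<circ> ?\<tau> X) i j
        = (\<Sum>l\<le>d. (entry d e Y l i * (g l / g i)) * (entry d e X j l * (g j / g l)))"
      by (simp add: entry_comp e E ent ij)
    also have "\<dots> = (\<Sum>l\<le>d. entry d e X j l * entry d e Y l i) * (g j / g i)"
      unfolding sum_distrib_right by (rule sum.cong) (simp_all add: g)
    finally show "entry d e (?\<tau> (X \<circ> Y)) i j = entry d e (?\<tau> Y \<circ> ?\<tau> X) i j"
      by (simp add: ent ij entry_comp e that)
  qed
  show ?thesis
    unfolding antiautomorphism_def using bij add scale comp by blast
qed

text \<open>
  The weighted transpose sends \<open>Y\<close> to \<open>Z\<close> if and only if \<open>Z i j = Y j i * (g j / g i)\<close>. Below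
  the diagonal these equations determine \<open>g\<close> recursively; above it they hold because the
  hypothesis on \<open>Y, Z\<close> makes the products of opposite entries equal; on it they say that the
  diagonals agree. The same equations send \<open>Z\<close> back to \<open>Y\<close>.
\<close>

lemma antiautomorphism_swap_exists:
  assumes e: "is_basis d e" and End: "X \<in> End" "Y \<in> End" "Z \<in> End"
    and diag: "\<And>j. j \<le> d \<Longrightarrow> X (e j) = s j *s e j"
    and Y: "irred_tridiag_wrt d e Y" and t: "\<And>i. i \<le> d \<Longrightarrow> t i \<noteq> 0"
    and YZ: "\<And>i j. i \<le> d \<Longrightarrow> j \<le> d \<Longrightarrow> entry d e Y i j * t j = t i * entry d e Z i j"
  shows "\<exists>\<tau>. antiautomorphism \<tau> \<and> \<tau> X = X \<and> \<tau> Y = Z \<and> \<tau> Z = Y"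
proof -
  let ?y = "entry d e Y" and ?z = "entry d e Z"
  obtain M where M: "represents d e Y M" "irreducible_tridiagonal d M"
    using Y by (auto simp: irred_tridiag_wrt_def)
  have y: "?y i j = M i j" if "i \<le> d" "j \<le> d" for i j
    by (rule entry_represents[OF e M(1) that])
  have tri: "?y i j = 0" if "i \<le> d" "j \<le> d" "i \<noteq> j" "i \<noteq> Suc j" "j \<noteq> Suc i" for i j
    using M(2) that by (auto simp: y irreducible_tridiagonal_def tridiagonal_def)
  have irr: "?y (Suc i) i \<noteq> 0" "?y i (Suc i) \<noteq> 0" if "i < d" for i
    using M(2) that by (auto simp: y irreducible_tridiagonal_def)
  have z: "?z i j = ?y i j * t j / t i" if "i \<le> d" "j \<le> d" for i j
    using YZ[OF that] t[OF that(1)] by (simp add: field_simps)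
  define g where "g i = (\<Prod>m<i. ?y m (Suc m) / ?z (Suc m) m)" for i
  have g: "g i \<noteq> 0" if "i \<le> d" for i
    using that by (auto simp: g_def z irr t)
  have gSuc: "g (Suc i) = g i * (?y i (Suc i) / ?z (Suc i) i)" for i
    by (simp add: g_def)
  have swap: "?z i j = ?y j i * (g j / g i)" if ij: "i \<le> d" "j \<le> d" for i j
  proof -
    consider "i = j" | "i = Suc j" | "j = Suc i" | "i \<noteq> j" "i \<noteq> Suc j" "j \<noteq> Suc i" by blast
    then show ?thesis
    proof cases
      case 1 then show ?thesis using ij by (simp add: z g t)
    next
      case 2
      then have "j < d" using ij by simp
      with 2 show ?thesis using g[of j] g[of i] ij irr[of j] t[of j] t[of i]
        by (simp add: gSuc z)
    next
      case 3
      then have "i < d" using ij by simp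
      with 3 show ?thesis using g[of j] g[of i] ij irr[of i] t[of j] t[of i]
        by (simp add: gSuc z)
    next
      case 4 then show ?thesis using ij by (simp add: z tri)
    qed
  qed
  let ?\<tau> = "weighted_transpose d e g"
  note ent = entry_weighted_transpose[OF e]
  have "?\<tau> X = X"
    by (rule End_eqI[OF e weighted_transpose_End[OF e] End(1)])
      (auto simp: ent g entry_diagonal[OF e diag])
  moreover have "?\<tau> Y = Z"
    by (rule End_eqI[OF e weighted_transpose_End[OF e] End(3)]) (simp add: ent swap)
  moreover have "?\<tau> Z = Y"
    by (rule End_eqI[OF e weighted_transpose_End[OF e] End(2)]) (simp add: ent swap g)
  ultimately show ?thesis using antiautomorphism_weighted_transpose[OF e, of g] g by blast
qed

section \<open>The triple in an eigenbasis of its diagonal member\<close>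

text \<open>Since \<open>W\<close> is invertible, the condition is \<open>Y W = W Z\<close>, with \<open>W\<close> diagonal in this basis.\<close>

lemma bar_map_eq_0_iff:
  assumes e: "is_basis d e" and End: "X \<in> End" "Y \<in> End" "Z \<in> End"
    and diag: "\<And>j. j \<le> d \<Longrightarrow> X (e j) = qracah_theta q d x j *s e j"
    and inj: "inj_on (qracah_theta q d x) {..d}" and "q \<noteq> 0" "x \<noteq> 0"
  shows "bar_map q d x X Y Z = (\<lambda>_. 0) \<longleftrightarrow>
    (\<forall>i\<le>d. \<forall>j\<le>d. entry d e Y i j * W_weight q d x j = W_weight q d x i * entry d e Z i j)"
proof -
  let ?t = "W_weight q d x" and ?W = "W_map q d x X"
  note t = W_weight_nonzero[OF assms(7,8)]
  have "?W v = (\<Sum>i\<le>d. (?t i * coord d e v i) *s e i)" for v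
    by (simp add: W_map_def primitive_idempotent_eq[OF e End(1) diag inj] W_weight_def)
  then have W: "coord d e (?W v) i = ?t i * coord d e v i" if "i \<le> d" for v i
    using that by (simp add: coord_combination e)
  have W_End: "?W \<in> End"
    by (rule EndI; rule coord_eqI[OF e]) (simp_all add: W coord_add coord_scale e algebra_simps)
  have "inj ?W"
  proof (rule injI)
    fix u v assume eq: "?W u = ?W v"
    show "u = v"
    proof (rule coord_eqI[OF e])
      fix i assume i: "i \<le> d"
      show "coord d e u i = coord d e v i" using W[OF i, of u] W[OF i, of v] t[of d i] eq by simp
    qed
  qed
  moreover have "?W (\<Sum>i\<le>d. (coord d e v i / ?t i) *s e i) = v" for v
    by (rule coord_eqI[OF e]) (simp add: W coord_combination e t)
  then have "surj ?W" by (rule surjI)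
  ultimately have bij: "bij ?W" by (simp add: bij_def)
  have "inv ?W u = w \<longleftrightarrow> u = ?W w" for u w
    using bij_inv_eq_iff[OF bij, of w u] by auto
  then have "bar_map q d x X Y Z = (\<lambda>_. 0) \<longleftrightarrow> Y \<circ> ?W = ?W \<circ> Z"
    by (simp add: bar_map_def fun_eq_iff)
  also have "\<dots> \<longleftrightarrow> (\<forall>i\<le>d. \<forall>j\<le>d. entry d e (Y \<circ> ?W) i j = entry d e (?W \<circ> Z) i j)"
  proof
    assume "Y \<circ> ?W = ?W \<circ> Z"
    then show "\<forall>i\<le>d. \<forall>j\<le>d. entry d e (Y \<circ> ?W) i j = entry d e (?W \<circ> Z) i j"
      by (simp only:) blast
  next
    assume "\<forall>i\<le>d. \<forall>j\<le>d. entry d e (Y \<circ> ?W) i j = entry d e (?W \<circ> Z) i j"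
    then show "Y \<circ> ?W = ?W \<circ> Z"
      by (intro End_eqI[OF e End_comp[OF End(2) W_End] End_comp[OF W_End End(3)]]) blast
  qed
  also have "\<dots> \<longleftrightarrow> (\<forall>i\<le>d. \<forall>j\<le>d. entry d e Y i j * ?t j = ?t i * entry d e Z i j)"
  proof -
    have "?W (e j) = ?t j *s e j" if "j \<le> d" for j
      by (rule coord_eqI[OF e]) (simp add: W coord_scale coord_basis e that)
    then have "entry d e (Y \<circ> ?W) i j = entry d e Y i j * ?t j" if "j \<le> d" for i j
      using that by (simp add: entry_def End_scale End coord_scale e)
    moreover have "entry d e (?W \<circ> Z) i j = ?t i * entry d e Z i j" if "i \<le> d" for i j
      using that by (simp add: entry_def W)
    ultimately show ?thesis by simp
  qed
  finally show ?thesis .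
qed

lemma qracah_relation_entries:
  assumes e: "is_basis d e" and End: "X \<in> End" "Y \<in> End" "Z \<in> End"
    and diag: "\<And>j. j \<le> d \<Longrightarrow> X (e j) = s j *s e j"
    and relY: "qracah_relation q \<beta> Y Z X" and relZ: "qracah_relation q \<gamma> Z X Y"
    and k: "q powi 2 - q powi (- 2) \<noteq> 0" and ij: "i \<le> d" "j \<le> d"
  shows "(q powi 2 - q powi (- 2)) * entry d e Z i j + (q * s i - inverse q * s j) * entry d e Y i j
      = (if i = j then (q powi 2 - q powi (- 2)) * \<gamma> else 0)"
    and "(q powi 2 - q powi (- 2)) * entry d e Y i j + (q * s j - inverse q * s i) * entry d e Z i j
      = (if i = j then (q powi 2 - q powi (- 2)) * \<beta> else 0)"
proof -
  let ?k = "q powi 2 - q powi (- 2)"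
  note c = coord_add[OF e] coord_diff[OF e] coord_scale[OF e] coord_basis[OF e ij]
    coord_diagonalizable[OF e End(1) diag ij(1)] diag[OF ij(2)]
  have "coord d e (Z (e j) + inverse ?k *s (q *s X (Y (e j)) - inverse q *s Y (X (e j)))) i
      = coord d e (\<gamma> *s e j) i"
    using relZ by (simp add: qracah_relation_def)
  then have "entry d e Z i j + inverse ?k * ((q * s i - inverse q * s j) * entry d e Y i j)
      = (if i = j then \<gamma> else 0)"
    by (simp add: c End_scale[OF End(2)] entry_def algebra_simps if_distrib cong: if_cong)
  from arg_cong[OF this, of "\<lambda>v. ?k * v"]
  show "?k * entry d e Z i j + (q * s i - inverse q * s j) * entry d e Y i j
      = (if i = j then ?k * \<gamma> else 0)"
    unfolding distrib_left mult.assoc[symmetric] right_inverse[OF k] by (simp split: if_splits)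
  have "coord d e (Y (e j) + inverse ?k *s (q *s Z (X (e j)) - inverse q *s X (Z (e j)))) i
      = coord d e (\<beta> *s e j) i"
    using relY by (simp add: qracah_relation_def)
  then have "entry d e Y i j + inverse ?k * ((q * s j - inverse q * s i) * entry d e Z i j)
      = (if i = j then \<beta> else 0)"
    by (simp add: c End_scale[OF End(3)] entry_def algebra_simps if_distrib cong: if_cong)
  from arg_cong[OF this, of "\<lambda>v. ?k * v"]
  show "?k * entry d e Y i j + (q * s j - inverse q * s i) * entry d e Z i j
      = (if i = j then ?k * \<beta> else 0)"
    unfolding distrib_left mult.assoc[symmetric] right_inverse[OF k] by (simp split: if_splits)
qed

lemma qracah_leonard_triple_rotate:
  "qracah_leonard_triple q a b c d A B C \<Longrightarrow> qracah_leonard_triple q b c a d B C A"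
  by (auto simp: qracah_leonard_triple_def leonard_triple_def)

text \<open>
  The equivalence attached to a single member \<open>X\<close> of the triple, as a cycle of three implications.
\<close>

lemma similar_bar_antiautomorphism:
  assumes T: "qracah_leonard_triple q x y z d X Y Z"
    and q: "q \<noteq> 0" "q ^ 4 \<noteq> 1" and nz: "x \<noteq> 0" "y \<noteq> 0" "z \<noteq> 0"
    and x: "d \<ge> 1 \<Longrightarrow> x\<^sup>2 \<noteq> 1"
  shows similar_imp_bar_eq_0: "similar_scalars y z \<Longrightarrow> bar_map q d x X Y Z = (\<lambda>_. 0)"
    and bar_eq_0_imp_swap: "bar_map q d x X Y Z = (\<lambda>_. 0) \<Longrightarrow>
      \<exists>\<tau>. antiautomorphism \<tau> \<and> \<tau> X = X \<and> \<tau> Y = Z \<and> \<tau> Z = Y"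
    and swap_imp_similar: "\<exists>\<tau>. antiautomorphism \<tau> \<and> \<tau> X = X \<and> \<tau> Y = Z \<and> \<tau> Z = Y \<Longrightarrow>
      similar_scalars y z"
proof -
  let ?k = "q powi 2 - q powi (- 2)" and ?t = "W_weight q d x" and ?s = "qracah_theta q d x"
  have End: "X \<in> End" "Y \<in> End" "Z \<in> End"
    using T by (auto simp: qracah_leonard_triple_def leonard_triple_def)
  obtain e where "leonard_basis d X Y Z e" and "\<forall>i\<le>d. e i \<in> eigenspace X (?s i)"
    and bX: "bij_betw ?s {..d} (eigenvalues X)"
    using T by (auto simp: qracah_leonard_triple_def standard_ordering_def)
  then have e: "is_basis d e" and triY: "irred_tridiag_wrt d e Y" and triZ: "irred_tridiag_wrt d e Z"
    and diag: "\<And>j. j \<le> d \<Longrightarrow> X (e j) = ?s j *s e j"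
    by (auto simp: leonard_basis_def eigenspace_def)
  obtain f where f: "is_basis d f" "\<And>j. j \<le> d \<Longrightarrow> Y (f j) = qracah_theta q d y j *s f j"
    and bY: "bij_betw (qracah_theta q d y) {..d} (eigenvalues Y)"
    using T by (auto simp: qracah_leonard_triple_def standard_ordering_def leonard_basis_def eigenspace_def)
  obtain h where h: "is_basis d h" "\<And>j. j \<le> d \<Longrightarrow> Z (h j) = qracah_theta q d z j *s h j"
    and bZ: "bij_betw (qracah_theta q d z) {..d} (eigenvalues Z)"
    using T by (auto simp: qracah_leonard_triple_def standard_ordering_def leonard_basis_def eigenspace_def)
  have rel: "qracah_relation q (qracah_alpha q d y z x) Y Z X"
    "qracah_relation q (qracah_alpha q d z x y) Z X Y"
    using T by (auto simp: qracah_leonard_triple_def)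
  have k: "?k \<noteq> 0" "q + inverse q \<noteq> 0" "q - inverse q \<noteq> 0"
    using q_square_diff_nonzero[OF q] by auto
  have kk: "?k = (q - inverse q) * (q + inverse q)"
    using q by (simp add: power_int_minus algebra_simps power2_eq_square)
  have inj: "inj_on ?s {..d}" using bX by (simp add: bij_betw_def)
  note t = W_weight_nonzero[OF q(1) nz(1)]
  have bar: "bar_map q d x X Y Z = (\<lambda>_. 0) \<longleftrightarrow>
      (\<forall>i\<le>d. \<forall>j\<le>d. entry d e Y i j * ?t j = ?t i * entry d e Z i j)"
    by (rule bar_map_eq_0_iff[OF e End diag inj q(1) nz(1)])
  have entriesZ: "?k * entry d e Z i j + (q * ?s i - inverse q * ?s j) * entry d e Y i j
      = (if i = j then ?k * qracah_alpha q d z x y else 0)"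
    if ij: "i \<le> d" "j \<le> d" for i j
    by (rule qracah_relation_entries(1)[OF e End diag rel k(1) ij])
  have entriesY: "?k * entry d e Y i j + (q * ?s j - inverse q * ?s i) * entry d e Z i j
      = (if i = j then ?k * qracah_alpha q d y z x else 0)"
    if ij: "i \<le> d" "j \<le> d" for i j
    by (rule qracah_relation_entries(2)[OF e End diag rel k(1) ij])

  show "bar_map q d x X Y Z = (\<lambda>_. 0)" if sim: "similar_scalars y z"
  proof -
    have yz: "y + inverse y = z + inverse z"
      using sim nz by (simp add: similar_scalars_iff)
    \<comment> \<open>The diagonal of \<open>X\<close>-bar, since conjugation by the diagonal \<open>W\<close> keeps diagonal entries.\<close>
    define \<delta> where "\<delta> i = entry d e Y i i - entry d e Z i i" for i
    have prod0: "\<delta> i * (q + inverse q - ?s i) = 0" if i: "i \<le> d" for i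
    proof -
      have al: "qracah_alpha q d y z x = qracah_alpha q d z x y"
        using qracah_alpha_diff[OF q, of d y z x] yz k by simp
      have "?k * entry d e Y i i + (q * ?s i - inverse q * ?s i) * entry d e Z i i
          = ?k * entry d e Z i i + (q * ?s i - inverse q * ?s i) * entry d e Y i i"
        unfolding entriesY[OF i i] entriesZ[OF i i] al ..
      moreover have "?k * \<delta> i - (q - inverse q) * (?s i * \<delta> i)
          = (?k * entry d e Y i i + (q * ?s i - inverse q * ?s i) * entry d e Z i i)
            - (?k * entry d e Z i i + (q * ?s i - inverse q * ?s i) * entry d e Y i i)"
        unfolding \<delta>_def by (simp only: algebra_simps)
      ultimately have "?k * \<delta> i = (q - inverse q) * (?s i * \<delta> i)" by simp
      then have "(q - inverse q) * (\<delta> i * (q + inverse q - ?s i)) = 0"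
        unfolding kk by (simp add: algebra_simps)
      then show ?thesis using k by simp
    qed
    have "(\<Sum>i\<le>d. qracah_theta q d y i) * (q - inverse q)
        = (\<Sum>i\<le>d. qracah_theta q d z i) * (q - inverse q)"
      by (simp only: sum_qracah_theta[OF q(1)] yz)
    then have sum0: "(\<Sum>i\<le>d. \<delta> i) = 0"
      using k(3) trace_diagonalizable[OF e f(1) End(2) f(2)] trace_diagonalizable[OF e h(1) End(3) h(2)]
      by (simp add: \<delta>_def sum_subtractf)
    \<comment> \<open>At most one \<open>\<theta>\<^sub>i\<close> equals \<open>q + 1/q\<close>, so a nonzero \<open>\<delta> i\<close> would be the whole sum.\<close>
    have \<delta>0: "\<delta> i = 0" if i: "i \<le> d" for i
    proof (rule ccontr)
      assume "\<delta> i \<noteq> 0"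
      then have si: "?s i = q + inverse q" using prod0[OF i] by simp
      have "\<delta> j = 0" if "j \<le> d" "j \<noteq> i" for j
        using prod0[OF that(1)] inj_onD[OF inj, of i j] i that by (auto simp flip: si)
      then have "(\<Sum>j\<le>d. \<delta> j) = (\<Sum>j\<le>d. if j = i then \<delta> i else 0)"
        by (intro sum.cong) auto
      then show False using \<open>\<delta> i \<noteq> 0\<close> sum0 i by simp
    qed
    have tri: "entry d e Y i j = 0" "entry d e Z i j = 0"
      if "i \<le> d" "j \<le> d" "i \<noteq> j" "i \<noteq> Suc j" "j \<noteq> Suc i" for i j
      using triY triZ that entry_represents[OF e]
      by (fastforce simp: irred_tridiag_wrt_def irreducible_tridiagonal_def tridiagonal_def)+
    have "entry d e Y i j * ?t j = ?t i * entry d e Z i j" if ij: "i \<le> d" "j \<le> d" for i j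
    proof (cases "i = Suc j \<or> j = Suc i")
      case True
      have "?t i * (q * ?s i - inverse q * ?s j) = - ?k * ?t j"
        using True ij W_weight_theta_neighbours[OF q(1) nz(1)] by (auto simp del: mult_minus_left)
      moreover have "?k * (?t i * entry d e Z i j)
          = - (?t i * (q * ?s i - inverse q * ?s j)) * entry d e Y i j"
      proof -
        have "?k * entry d e Z i j = - ((q * ?s i - inverse q * ?s j) * entry d e Y i j)"
          using entriesZ[OF ij] True by (auto simp: eq_neg_iff_add_eq_0)
        then show ?thesis by (simp add: mult.left_commute mult.assoc)
      qed
      ultimately have "?k * (?t i * entry d e Z i j) = ?k * (?t j * entry d e Y i j)"
        by (simp only: mult_minus_left minus_minus mult.assoc)
      then show ?thesis using k(1) by (simp add: mult.commute)
    next
      case False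
      then show ?thesis
        using tri[OF ij] \<delta>0[OF ij(1)] by (cases "i = j") (auto simp: \<delta>_def)
    qed
    then show ?thesis by (simp add: bar)
  qed

  show "\<exists>\<tau>. antiautomorphism \<tau> \<and> \<tau> X = X \<and> \<tau> Y = Z \<and> \<tau> Z = Y"
    if "bar_map q d x X Y Z = (\<lambda>_. 0)"
    using that bar by (intro antiautomorphism_swap_exists[OF e End diag triY t]) auto

  show "similar_scalars y z"
    if swap: "\<exists>\<tau>. antiautomorphism \<tau> \<and> \<tau> X = X \<and> \<tau> Y = Z \<and> \<tau> Z = Y"
  proof -
    obtain \<tau> where \<tau>: "antiautomorphism \<tau>" "\<tau> X = X" "\<tau> Y = Z" "\<tau> Z = Y"
      using swap by (elim exE conjE)
    have "eigenvalues Y = eigenvalues Z"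
      using eigenvalues_antiautomorphism_subset[OF e \<tau>(1) End(2)]
        eigenvalues_antiautomorphism_subset[OF e \<tau>(1) End(3)] \<tau> by auto
    then have sums: "(\<Sum>i\<le>d. qracah_theta q d y i) = (\<Sum>i\<le>d. qracah_theta q d z i)"
      using sum.reindex_bij_betw[OF bY, of "\<lambda>v. v"] sum.reindex_bij_betw[OF bZ, of "\<lambda>v. v"] by simp
    have rel': "qracah_relation q (qracah_alpha q d y z x) Z X Y"
      using qracah_relation_antiautomorphism[OF \<tau>(1) End(2,3,1) rel(1)] \<tau> by simp
    have "qracah_alpha q d y z x *s e 0 = qracah_alpha q d z x y *s e 0"
      by (rule trans[OF sym[OF spec[OF rel'[unfolded qracah_relation_def]]]
            spec[OF rel(2)[unfolded qracah_relation_def]]])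
    then have "qracah_alpha q d y z x = qracah_alpha q d z x y"
      using basis_nonzero[OF e] by simp
    then show ?thesis using similar_of_sum_and_alpha[OF q nz x sums] by simp
  qed
qed

end

theorem corollary14p3:
  fixes scale :: "'a::field \<Rightarrow> 'b::ab_group_add \<Rightarrow> 'b"
    and q a b c :: 'a
    and d :: nat
    and A B C :: "'b \<Rightarrow> 'b"
  assumes "vector_space scale"
    and "vector_space.dim scale (UNIV :: 'b set) = d + 1"
    and "q \<noteq> 0" and "q ^ 4 \<noteq> 1"
    and "a \<noteq> 0" and "b \<noteq> 0" and "c \<noteq> 0"
    and "\<forall>i. 1 \<le> i \<and> i \<le> d \<longrightarrow> q ^ (2 * i) \<noteq> 1"
    and "\<forall>k::int. 1 - int d \<le> k \<and> k \<le> int d - 1 \<longrightarrow>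
           a ^ 2 \<noteq> q powi (2 * k) \<and> b ^ 2 \<noteq> q powi (2 * k) \<and> c ^ 2 \<noteq> q powi (2 * k)"
    and "\<forall>i<d. a * b * c \<noteq> q powi (int d - 1 - 2 * int i) \<and>
           inverse a * b * c \<noteq> q powi (int d - 1 - 2 * int i) \<and>
           a * inverse b * c \<noteq> q powi (int d - 1 - 2 * int i) \<and>
           a * b * inverse c \<noteq> q powi (int d - 1 - 2 * int i)"
    and "vector_space.qracah_leonard_triple scale q a b c d A B C"
  shows "(vector_space.bar_map scale q d a A B C = (\<lambda>_. 0) \<and>
          vector_space.bar_map scale q d b B C A = (\<lambda>_. 0) \<and>
          vector_space.bar_map scale q d c C A B = (\<lambda>_. 0)
            \<longleftrightarrow> similar_scalars a b \<and> similar_scalars b c \<and> similar_scalars a c) \<and>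
         (similar_scalars a b \<and> similar_scalars b c \<and> similar_scalars a c
            \<longleftrightarrow> vector_space.modular scale A B C)"
proof -
  interpret vector_space scale by fact
  note T1 = assms(11)
  note T2 = qracah_leonard_triple_rotate[OF T1]
  note T3 = qracah_leonard_triple_rotate[OF T2]
  \<comment> \<open>The exponent \<open>k = 0\<close> lies in the excluded range as soon as \<open>d \<ge> 1\<close>.\<close>
  have "a\<^sup>2 \<noteq> 1 \<and> b\<^sup>2 \<noteq> 1 \<and> c\<^sup>2 \<noteq> 1" if "d \<ge> 1"
    using assms(9)[rule_format, of 0] that by simp
  then have sq: "d \<ge> 1 \<Longrightarrow> a\<^sup>2 \<noteq> 1" "d \<ge> 1 \<Longrightarrow> b\<^sup>2 \<noteq> 1" "d \<ge> 1 \<Longrightarrow> c\<^sup>2 \<noteq> 1" by blast+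
  note cyc1 = similar_bar_antiautomorphism[OF T1 assms(3,4,5,6,7) sq(1)]
  note cyc2 = similar_bar_antiautomorphism[OF T2 assms(3,4,6,7,5) sq(2)]
  note cyc3 = similar_bar_antiautomorphism[OF T3 assms(3,4,7,5,6) sq(3)]
  have sym: "similar_scalars c a \<longleftrightarrow> similar_scalars a c"
    by (auto simp: similar_scalars_def mult.commute)
  show ?thesis
    unfolding modular_def using cyc1 cyc2 cyc3 sym by blast
qed

end
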